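(* Let $(X,d)$ be a complete metric space with $|X|\geqslant 3$ and let the mapping $T\colon X\to X$ satisfy the following two conditions: (i) $T(T(x))\neq x$ for all $x\in X$ such that $Tx\neq x$; (ii) $T$ is a mapping contracting perimeters of triangles on $X$. Then $T$ has a fixed point. Moreover, the number of fixed points of $T$ is at most two.
   Context: Here $|X|$ denotes the cardinality of the set $X$, and $X$ may be finite or infinite. Definition: let $(X,d)$ be a metric space with $|X|\geqslant 3$. A mapping $T\colon X\to X$ is called a mapping contracting perimeters of triangles on $X$ if there exists $\alpha\in[0,1)$ such that the inequality $$d(Tx,Ty)+d(Ty,Tz)+d(Tx,Tz)\leqslant \alpha\,\bigl(d(x,y)+d(y,z)+d(x,z)\bigr)$$ holds for all triples of pairwise distinct points $x,y,z\in X$. *)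

theory Defs
  imports "HOL-Analysis.Analysis"
begin

definition contracting_triangle_perimeters ::
    "'a set \<Rightarrow> ('a \<Rightarrow> 'a \<Rightarrow> real) \<Rightarrow> ('a \<Rightarrow> 'a) \<Rightarrow> bool" where
  "contracting_triangle_perimeters X d T \<longleftrightarrow>
    (\<exists>\<alpha>. 0 \<le> \<alpha> \<and> \<alpha> < 1 \<and>
      (\<forall>x\<in>X. \<forall>y\<in>X. \<forall>z\<in>X. x \<noteq> y \<longrightarrow> y \<noteq> z \<longrightarrow> x \<noteq> z \<longrightarrow>
        d (T x) (T y) + d (T y) (T z) + d (T x) (T z) \<le> \<alpha> * (d x y + d y z + d x z)))"

end

theory Submission
  imports Defs
begin

text \<open>
  If \<open>T\<close> had no fixed point, the hypothesis \<open>T (T x) \<noteq> x\<close> would make any three consecutive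
  points of a Picard orbit distinct, so their perimeters, and hence the consecutive distances,
  decay geometrically and the orbit converges to some \<open>l\<close>. Since \<open>l\<close> occurs at most once in
  any three consecutive orbit points, there are arbitrarily large \<open>m\<close> for which the \<open>m\<close>-th and
  the next orbit point both differ from \<open>l\<close>; contracting the triangle they form with \<open>l\<close> gives \<open>T l = l\<close>.
  Three distinct fixed points would span a triangle whose perimeter is preserved.
\<close>

text \<open>The triangle inequality bounds \<open>d (u m) (u n)\<close>, for
  \<open>m \<le> n\<close>, by a block of the geometric series, hence by its tail
  \<open>c / (1 - \<alpha>) * \<alpha> ^ m\<close>, which does not depend on \<open>n\<close> and
  tends to 0.\<close>

lemma (in Metric_space) MCauchy_geometric:
  fixes u :: "nat \<Rightarrow> 'a" and \<alpha> c :: real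
  assumes u: "\<And>n. u n \<in> M" and \<alpha>: "0 \<le> \<alpha>" "\<alpha> < 1"
    and step: "\<And>n. d (u n) (u (Suc n)) \<le> \<alpha> ^ n * c"
  shows "MCauchy u"
proof -
  have "d (u 0) (u 1) \<le> c" using step[of 0] by simp
  then have c: "0 \<le> c" using nonneg[of "u 0" "u 1"] by linarith
  \<comment> \<open>This is the closed form of the partial geometric sum, multiplied out by
    \<open>1 - \<alpha>\<close> so that the induction step is a polynomial identity.\<close>
  have telescope: "(1 - \<alpha>) * d (u m) (u (m + k)) \<le> c * (\<alpha> ^ m - \<alpha> ^ (m + k))" for m k
  proof (induction k)
    case 0
    then show ?case using u by simp
  next
    case (Suc k)
    have "d (u m) (u (m + Suc k)) \<le> d (u m) (u (m + k)) + \<alpha> ^ (m + k) * c"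
      using triangle[OF u[of m] u[of "m + k"] u[of "m + Suc k"]] step[of "m + k"] by simp
    then have "(1 - \<alpha>) * d (u m) (u (m + Suc k))
        \<le> (1 - \<alpha>) * (d (u m) (u (m + k)) + \<alpha> ^ (m + k) * c)"
      using \<alpha> by (intro mult_left_mono) auto
    with Suc show ?case by (simp add: algebra_simps)
  qed
  have dist_le: "d (u m) (u n) \<le> c / (1 - \<alpha>) * \<alpha> ^ m" if "m \<le> n" for m n
  proof -
    have "(1 - \<alpha>) * d (u m) (u n) \<le> c * (\<alpha> ^ m - \<alpha> ^ n)"
      using telescope[of m "n - m"] that by simp
    also have "\<dots> \<le> c * \<alpha> ^ m"
      using c \<alpha> by (intro mult_left_mono) auto
    finally show ?thesis using \<alpha> by (simp add: field_simps)
  qed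
  have lim: "(\<lambda>m. c / (1 - \<alpha>) * \<alpha> ^ m) \<longlonglongrightarrow> 0"
    using LIMSEQ_realpow_zero[OF \<alpha>] by (intro tendsto_mult_right_zero)
  have "\<exists>N. \<forall>n n'. N \<le> n \<longrightarrow> N \<le> n' \<longrightarrow> d (u n) (u n') < \<epsilon>" if "0 < \<epsilon>" for \<epsilon>
  proof -
    obtain N where N: "\<And>n. N \<le> n \<Longrightarrow> c / (1 - \<alpha>) * \<alpha> ^ n < \<epsilon>"
      using order_tendstoD(2)[OF lim \<open>0 < \<epsilon>\<close>] unfolding eventually_sequentially by blast
    have "d (u n) (u n') < \<epsilon>" if "N \<le> n" "N \<le> n'" for n n'
      using that
    proof (induction n n' rule: linorder_wlog)
      case (le n n')
      then show ?case using dist_le[of n n'] N[of n] by simp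
    next
      case (sym n n')
      then show ?case by (simp add: commute)
    qed
    then show ?thesis by blast
  qed
  then show ?thesis using u unfolding MCauchy_def by blast
qed

theorem theorem2p4:
  fixes X :: "'a set" and d :: "'a \<Rightarrow> 'a \<Rightarrow> real" and T :: "'a \<Rightarrow> 'a"
  assumes "Metric_space X d"
    and "Metric_space.mcomplete X d"
    and "infinite X \<or> card X \<ge> 3"
    and "T \<in> X \<rightarrow> X"
    and "\<forall>x\<in>X. T x \<noteq> x \<longrightarrow> T (T x) \<noteq> x"
    and "contracting_triangle_perimeters X d T"
  shows "(\<exists>x\<in>X. T x = x) \<and> finite {x \<in> X. T x = x} \<and> card {x \<in> X. T x = x} \<le> 2"
proof -
  interpret Metric_space X d by fact
  obtain \<alpha> where \<alpha>: "0 \<le> \<alpha>" "\<alpha> < 1"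
    and contr: "\<And>x y z. \<lbrakk>x \<in> X; y \<in> X; z \<in> X; x \<noteq> y; y \<noteq> z; x \<noteq> z\<rbrakk> \<Longrightarrow>
        d (T x) (T y) + d (T y) (T z) + d (T x) (T z) \<le> \<alpha> * (d x y + d y z + d x z)"
    using assms(6) unfolding contracting_triangle_perimeters_def by metis
  have ex: "\<exists>x\<in>X. T x = x"
  proof (rule ccontr)
    assume "\<not> ?thesis"
    then have nofix: "T x \<noteq> x" "T (T x) \<noteq> x" if "x \<in> X" for x
      using assms(5) that by blast+
    obtain x0 where x0: "x0 \<in> X" using assms(3) by (cases "X = {}") auto
    define u where "u n = (T ^^ n) x0" for n
    have u_Suc: "u (Suc n) = T (u n)" for n by (simp add: u_def)
    have u: "u n \<in> X" for n
      by (induction n) (use x0 assms(4) in \<open>auto simp: u_def\<close>)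
    \<comment> \<open>The remaining pair of the triangle, \<open>u (Suc n)\<close> and
      \<open>u (Suc (Suc n))\<close>, is the first fact at \<open>Suc n\<close>.\<close>
    have distinct: "u n \<noteq> u (Suc n)" "u n \<noteq> u (Suc (Suc n))" for n
      using nofix[OF u[of n]] by (metis u_Suc)+
    define p where
      "p n = d (u n) (u (Suc n)) + d (u (Suc n)) (u (Suc (Suc n))) + d (u n) (u (Suc (Suc n)))" for n
    have p_le: "p n \<le> \<alpha> ^ n * p 0" for n
    proof (induction n)
      case (Suc n)
      have "p (Suc n) \<le> \<alpha> * p n"
        using contr[OF u u u distinct(1) distinct(1) distinct(2), of n]
        by (simp add: p_def u_Suc)
      also have "\<dots> \<le> \<alpha> * (\<alpha> ^ n * p 0)"
        using Suc \<alpha> by (intro mult_left_mono)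
      finally show ?case by (simp add: mult.assoc)
    qed simp
    have "d (u n) (u (Suc n)) \<le> \<alpha> ^ n * p 0" for n
    proof -
      have "d (u n) (u (Suc n)) \<le> p n" by (simp add: p_def)
      then show ?thesis using p_le[of n] by linarith
    qed
    then have "MCauchy u"
      by (rule MCauchy_geometric[OF u \<alpha>])
    then obtain l where "limitin mtopology u l sequentially"
      using assms(2) unfolding mcomplete_def by blast
    then have l: "l \<in> X" and lim: "\<And>\<epsilon>. 0 < \<epsilon> \<Longrightarrow> \<exists>N. \<forall>n\<ge>N. d (u n) l < \<epsilon>"
      unfolding limit_metric_sequentially by blast+
    have Tl: "T l \<in> X" using l assms(4) by blast
    have pos: "0 < d l (T l)" using mdist_pos_eq[OF l Tl] nofix(1)[OF l] by metis
    \<comment> \<open>The final estimate bounds \<open>d l (T l)\<close> by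
      \<open>2 * d (u m) l + 3 * d (u (Suc m)) l\<close>, five small distances in all; hence the
      5.\<close>
    then obtain N where N: "\<And>n. N \<le> n \<Longrightarrow> d (u n) l < d l (T l) / 5"
      using lim[of "d l (T l) / 5"] by auto
    obtain m where m: "N \<le> m" "u m \<noteq> l" "u (Suc m) \<noteq> l"
    proof -
      \<comment> \<open>If one of the two orbit points equals \<open>l\<close>, the two points right
        after it differ from it by \<open>distinct\<close>, so \<open>m\<close> starts
        there.\<close>
      consider "u N = l" | "u (Suc N) = l" | "u N \<noteq> l" "u (Suc N) \<noteq> l" by blast
      then show thesis
      proof cases
        case 1
        then show ?thesis using that[of "Suc N"] distinct[of N] by auto
      next
        case 2
        then show ?thesis using that[of "Suc (Suc N)"] distinct[of "Suc N"] by auto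
      next
        case 3
        then show ?thesis using that[of N] by simp
      qed
    qed
    have "d (u (Suc m)) (T l)
        \<le> d (u (Suc m)) (u (Suc (Suc m))) + d (u (Suc (Suc m))) (T l) + d (u (Suc m)) (T l)"
      by simp
    also have "\<dots> \<le> \<alpha> * (d (u m) (u (Suc m)) + d (u (Suc m)) l + d (u m) l)"
      using contr[OF u u l distinct(1) m(3,2)] by (simp add: u_Suc)
    also have "\<dots> \<le> d (u m) (u (Suc m)) + d (u (Suc m)) l + d (u m) l"
      using \<alpha> by (intro mult_left_le_one_le) auto
    finally have "d (u (Suc m)) (T l) \<le> \<dots>" .
    moreover have "d (u m) (u (Suc m)) \<le> d (u m) l + d (u (Suc m)) l"
      using triangle[OF u l u] by (simp add: commute)
    moreover have "d l (T l) \<le> d (u (Suc m)) l + d (u (Suc m)) (T l)"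
      using triangle[OF l u Tl] by (simp add: commute)
    ultimately show False
      using N[of m] N[of "Suc m"] m(1) by simp
  qed
  have "finite {x \<in> X. T x = x} \<and> card {x \<in> X. T x = x} \<le> 2"
  proof (rule ccontr)
    assume "\<not> ?thesis"
    \<comment> \<open>The negated goal leaves two cases, infinitely many fixed points or a finite
      number of at least 3; one library fact serves each.\<close>
    then obtain S where "S \<subseteq> {x \<in> X. T x = x}" "card S = 3"
      using infinite_arbitrarily_large[of "{x \<in> X. T x = x}" 3]
        obtain_subset_with_card_n[of 3 "{x \<in> X. T x = x}"] by force
    then obtain x y z where xyz: "x \<in> X" "y \<in> X" "z \<in> X" "x \<noteq> y" "y \<noteq> z" "x \<noteq> z"
      and fixed: "T x = x" "T y = y" "T z = z"
      by (auto simp: card_3_iff)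
    have "0 < d x y + d y z + d x z"
      using xyz by (simp add: add_pos_nonneg)
    moreover have "d x y + d y z + d x z \<le> \<alpha> * (d x y + d y z + d x z)"
      using contr[OF xyz] by (simp add: fixed)
    ultimately show False using \<alpha> by (simp add: mult_le_cancel_right1)
  qed
  with ex show ?thesis by blast
qed

end
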